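(* There is an absolute constant $C>0$ such that the following holds. Let $\tau>0$ and $n\ge 1$ be such that $\tau n$ is a positive integer, and let $S,T\subseteq\{-1,1\}^n$ be nonempty. Let $\sigma\in[0,1]$ be the fractional size of $S$, i.e. $\sigma=|S|/2^n$, and let $\alpha\ge 0$ be such that $|T|/2^n=\sigma^\alpha$. Let $p^{(\tau n)}(S,T)$ be the probability that the standard random walk on the discrete cube, started from a uniformly random vertex of $S$ and run for $\tau n$ steps, ends in $T$. Then $$p^{(\tau n)}(S,T)\ \ge\ \sigma^{\frac{(\sqrt{\alpha}+\exp(-\tau))^2}{1-\exp(-2\tau)}}\ -\ C\,\frac{\sigma^{(-1+\alpha)/2}}{\tau n}.$$ In particular, when $|S|=|T|=\sigma 2^n$, $$p^{(\tau n)}(S,T)\ \ge\ \sigma^{\frac{1+\exp(-\tau)}{1-\exp(-\tau)}}-\frac{C}{\tau n}.$$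
   Context: The standard random walk on $\{-1,1\}^n$: at each time step, independently, with probability $1/2$ the walk does nothing, and for each $i\in\{1,\dots,n\}$, with probability $\frac{1}{2n}$ it walks along the $i$th edge, i.e. flips coordinate $i$. *)

theory Defs
  imports "HOL-Probability.Probability"
begin

text \<open>Vertices are sign vectors indexed by the coordinates \<open>1, \<dots>, n\<close>; extensionality outside
  \<open>{1..n}\<close> makes the representation unique, so that the cube has exactly \<open>2 ^ n\<close> elements.\<close>

definition cube :: "nat \<Rightarrow> (nat \<Rightarrow> int) set" where
  "cube n = {1..n} \<rightarrow>\<^sub>E {-1, 1}"

definition flip :: "nat \<Rightarrow> (nat \<Rightarrow> int) \<Rightarrow> nat \<Rightarrow> int" where
  "flip i x = x(i := - x i)"

text \<open>A fair coin decides whether to stay put; otherwise a uniformly random coordinate is flipped,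
  so each coordinate is flipped with probability \<open>1 / (2 * n)\<close>. Meaningful only for \<open>n \<ge> 1\<close>.\<close>

definition walk_step :: "nat \<Rightarrow> (nat \<Rightarrow> int) \<Rightarrow> (nat \<Rightarrow> int) pmf" where
  "walk_step n x =
     bind_pmf (bernoulli_pmf (1 / 2))
       (\<lambda>stay. if stay then return_pmf x
               else map_pmf (\<lambda>i. flip i x) (pmf_of_set {1..n}))"

primrec walk :: "nat \<Rightarrow> (nat \<Rightarrow> int) pmf \<Rightarrow> nat \<Rightarrow> (nat \<Rightarrow> int) pmf" where
  "walk n \<mu> 0 = \<mu>"
| "walk n \<mu> (Suc t) = bind_pmf (walk n \<mu> t) (walk_step n)"

definition walk_prob :: "nat \<Rightarrow> nat \<Rightarrow> (nat \<Rightarrow> int) set \<Rightarrow> (nat \<Rightarrow> int) set \<Rightarrow> real" where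
  "walk_prob n t S T = measure_pmf.prob (walk n (pmf_of_set S) t) T"

lemma finite_cube: "finite (cube n)"
  by (simp add: cube_def finite_PiE)

lemma card_cube: "card (cube n) = 2 ^ n"
  by (simp add: cube_def card_PiE numeral_2_eq_2)

lemma flip_in_cube: "x \<in> cube n \<Longrightarrow> i \<in> {1..n} \<Longrightarrow> flip i x \<in> cube n"
  by (fastforce simp: cube_def flip_def PiE_iff extensional_def)

lemma flip_eq_iff:
  assumes "x \<in> cube n" "i \<in> {1..n}"
  shows "flip j x = flip i x \<longleftrightarrow> j = i"
proof
  assume *: "flip j x = flip i x"
  show "j = i"
  proof (rule ccontr)
    assume "j \<noteq> i"
    with fun_cong[OF *, of i] have "x i = - x i" by (simp add: flip_def)
    moreover have "x i \<in> {-1, 1}" using assms by (auto simp: cube_def PiE_iff)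
    ultimately show False by auto
  qed
qed simp

lemma flip_neq:
  assumes "x \<in> cube n" "i \<in> {1..n}"
  shows "flip i x \<noteq> x"
proof
  assume "flip i x = x"
  from fun_cong[OF this, of i] have "x i = - x i" by (simp add: flip_def)
  moreover have "x i \<in> {-1, 1}" using assms by (auto simp: cube_def PiE_iff)
  ultimately show False by auto
qed

lemma pmf_walk_step_stay:
  assumes "n \<ge> 1" "x \<in> cube n"
  shows "pmf (walk_step n x) x = 1 / 2"
proof -
  have "(\<lambda>i. flip i x) -` {x} \<inter> {1..n} = {}"
    using flip_neq[OF assms(2)] by auto
  moreover have "{1..n} \<noteq> {}" using assms by simp
  ultimately show ?thesis
    by (simp add: walk_step_def pmf_bind pmf_map measure_pmf_of_set Int_commute)
qed

lemma pmf_walk_step_flip: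
  assumes "x \<in> cube n" "i \<in> {1..n}"
  shows "pmf (walk_step n x) (flip i x) = 1 / (2 * real n)"
proof -
  have "(\<lambda>j. flip j x) -` {flip i x} \<inter> {1..n} = {i}"
    using flip_eq_iff[OF assms] assms(2) by auto
  moreover have "{1..n} \<noteq> {}" using assms by auto
  moreover have "x \<noteq> flip i x" using flip_neq[OF assms] by simp
  ultimately show ?thesis
    by (simp add: walk_step_def pmf_bind pmf_map measure_pmf_of_set Int_commute)
qed

end

theory Submission imports Defs begin

text \<open>The walk is compared with the noise operator of correlation \<open>\<rho> = exp (- \<tau>)\<close>, which
  rerandomizes the coordinates independently and for which a sharp lower bound is available.

  For the noise operator, the bound is an instance of Borell's reverse hypercontractive inequality
  (\<open>reverse_hypercontractive\<close>): if \<open>0 < p, q < 1\<close> and \<open>(1 - p) (1 - q) = \<rho>\<^sup>2\<close>, then the noise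
  form of two nonnegative functions is at least the product of the \<open>p\<close>-norm of one and the \<open>q\<close>-norm
  of the other. By induction on the dimension this reduces to functions of one coordinate. There it
  follows from a single estimate (\<open>two_point_norm_le\<close>): the \<open>p\<close>-norm of a function with mean \<open>c\<close> and
  half-difference \<open>d\<close> is at most the square root of \<open>c\<^sup>2 - (1 - p) d\<^sup>2\<close>. That estimate
  in turn is a comparison of binomial series, coefficient by coefficient. Applied to indicator functions
  with the optimal \<open>p\<close> and \<open>q\<close>, the inequality yields exactly the main term
  (\<open>noise_kernel_sets_ge_powr\<close>).

  The walk and the noise operator have the same eigenfunctions, the characters of the cube. After
  \<open>t = \<tau> n\<close> steps a character of degree \<open>k\<close> has been multiplied by \<open>(1 - k/n) ^ t\<close>, whereas the noise
  operator multiplies it by \<open>exp (- \<tau> k) = exp (- t (k/n))\<close>. These numbers differ by at most \<open>2/t\<close>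
  (\<open>exp_minus_power_close\<close>). By Parseval's identity and the Cauchy--Schwarz inequality, the two
  transition probabilities then differ by at most \<open>2/t\<close> times the square root of \<open>|S| |T|\<close>, divided
  by \<open>|S|\<close> (\<open>walk_prob_ge_noise\<close>). This is the error term, so that \<open>C = 2\<close> works. The bound for
  sets of equal size is the case \<open>\<alpha> = 1\<close>.\<close>

section \<open>The two-point inequality\<close>

lemma gbinomial_Suc_quotient:
  fixes a :: real
  shows "a gchoose Suc m = (a gchoose m) * (a - real m) / (real m + 1)"
  using gbinomial_mult_1[of a m] by (simp add: field_simps)

text \<open>The recurrence is applied twice per step and every factor \<open>p - 2j\<close> is matched with a
  factor \<open>p/2 - j\<close>. What remains of the factors \<open>p - (2j + 1)\<close> is the product on the right.\<close>

lemma gbinomial_even: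
  fixes p :: real
  shows "p gchoose (2 * k) =
    (p / 2 gchoose k) * (-1) ^ k * (\<Prod>j<k. 1 - p / (2 * real j + 1))"
proof (induction k)
  case 0
  show ?case by simp
next
  case (Suc k)
  have "p gchoose (2 * Suc k) = (p gchoose Suc (Suc (2 * k)))"
    by simp
  also have "\<dots> = (p gchoose (2 * k)) * ((p - 2 * real k) * (p - (2 * real k + 1))
      / ((2 * real k + 1) * (2 * real k + 2)))"
    by (simp only: gbinomial_Suc_quotient) (simp add: algebra_simps)
  also have "(p - 2 * real k) * (p - (2 * real k + 1)) / ((2 * real k + 1) * (2 * real k + 2))
      = ((p / 2 - real k) / (real k + 1)) * (-1) * (1 - p / (2 * real k + 1))"
    by (simp add: divide_simps) (simp add: algebra_simps)
  finally show ?case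
    unfolding Suc.IH gbinomial_Suc_quotient by simp
qed

text \<open>Since \<open>1 - p/(2j + 1) \<ge> 1 - p\<close>, the leftover product is at least \<open>(1 - p) ^ k\<close>.
  It multiplies \<open>(-1) ^ k\<close> times the binomial coefficient of \<open>p/2\<close>, which is negative for
  \<open>0 < p < 1\<close> and \<open>k \<ge> 1\<close>, so the inequality is reversed.\<close>

lemma gbinomial_even_le:
  fixes p :: real
  assumes "0 < p" "p < 1"
  shows "p gchoose (2 * k) \<le> (p / 2 gchoose k) * (- (1 - p)) ^ k"
proof (cases k)
  case 0
  then show ?thesis by simp
next
  case (Suc m)
  have sign: "(p / 2 gchoose Suc m) * (-1) ^ Suc m \<le> 0" for m
  proof (induction m)
    case 0
    show ?case using assms by simp
  next
    case (Suc m)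
    have "(p / 2 gchoose Suc (Suc m)) * (-1) ^ Suc (Suc m) =
        ((p / 2 gchoose Suc m) * (-1) ^ Suc m) * ((real (Suc m) - p / 2) / (real (Suc m) + 1))"
    proof -
      have "g * (a - c) / e * (- 1 * s) = g * s * ((c - a) / e)" for g a c e s :: real
        by (simp add: algebra_simps diff_divide_distrib)
      then show ?thesis
        by (subst gbinomial_Suc_quotient, subst power_Suc)
    qed
    also have "\<dots> \<le> 0"
      using assms by (intro mult_nonpos_nonneg[OF Suc] divide_nonneg_nonneg) auto
    finally show ?case .
  qed
  have "(1 - p) ^ k \<le> (\<Prod>j<k. 1 - p / (2 * real j + 1))"
  proof -
    have "(\<Prod>j<k. 1 - p) \<le> (\<Prod>j<k. 1 - p / (2 * real j + 1))"
      using assms by (intro prod_mono) (auto simp: divide_simps algebra_simps)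
    then show ?thesis by simp
  qed
  then have "(p / 2 gchoose k) * (-1) ^ k * (\<Prod>j<k. 1 - p / (2 * real j + 1))
      \<le> (p / 2 gchoose k) * (-1) ^ k * (1 - p) ^ k"
    using sign[of m] unfolding Suc by (rule mult_left_mono_neg)
  also have "\<dots> = (p / 2 gchoose k) * (- (1 - p)) ^ k"
    using power_mult_distrib[of "-1" "1 - p" k] by simp
  finally show ?thesis
    by (simp only: gbinomial_even)
qed

text \<open>Both sides are power series in \<open>x\<^sup>2\<close>, and the bound holds coefficient by
  coefficient. In terms of \<open>M\<close>, the \<open>p\<close>-mean of \<open>1 + x\<close> and \<open>1 - x\<close>, it says that
  \<open>M\<^sup>2 \<le> 1 - (1 - p) x\<^sup>2\<close>. This is sharp at both ends: there is equality at
  \<open>p = 1\<close> and, for the geometric mean, at \<open>p = 0\<close>.\<close>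

lemma power_mean_le_open:
  fixes p x :: real
  assumes "0 < p" "p < 1" "\<bar>x\<bar> < 1"
  shows "((1 + x) powr p + (1 - x) powr p) / 2 \<le> (1 - (1 - p) * x\<^sup>2) powr (p / 2)"
proof (rule sums_le)
  show "(p gchoose (2 * k)) * x ^ (2 * k) \<le> (p / 2 gchoose k) * (- ((1 - p) * x\<^sup>2)) ^ k" for k
  proof -
    have "(p gchoose (2 * k)) * x ^ (2 * k) \<le> (p / 2 gchoose k) * (- (1 - p)) ^ k * x ^ (2 * k)"
      using gbinomial_even_le[OF assms(1,2), of k] by (intro mult_right_mono) auto
    also have "\<dots> = (p / 2 gchoose k) * (- ((1 - p) * x\<^sup>2)) ^ k"
      using power_mult_distrib[of "- (1 - p)" "x\<^sup>2" k]
      by (simp only: power_mult mult_minus_left mult.assoc)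
    finally show ?thesis .
  qed
  have "(\<lambda>n. ((p gchoose n) * x ^ n + (p gchoose n) * (- x) ^ n) / 2) sums
      (((1 + x) powr p + (1 + (- x)) powr p) / 2)"
    using assms(3) by (intro sums_divide sums_add gen_binomial_real) auto
  then have "(\<lambda>n. ((p gchoose n) * x ^ n + (p gchoose n) * (- x) ^ n) / 2) sums
      (((1 + x) powr p + (1 - x) powr p) / 2)"
    by simp
  then have "(\<lambda>k. ((p gchoose (2 * k)) * x ^ (2 * k) + (p gchoose (2 * k)) * (- x) ^ (2 * k)) / 2)
      sums (((1 + x) powr p + (1 - x) powr p) / 2)"
  proof (subst sums_mono_reindex[of "\<lambda>k. 2 * k"])
    show "strict_mono (\<lambda>k::nat. 2 * k)" by (simp add: strict_mono_def)
    fix n :: nat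
    assume "n \<notin> range (\<lambda>k. 2 * k)"
    then have "odd n" by (auto elim!: evenE)
    then show "((p gchoose n) * x ^ n + (p gchoose n) * (- x) ^ n) / 2 = 0" by simp
  qed
  then show "(\<lambda>k. (p gchoose (2 * k)) * x ^ (2 * k)) sums
      (((1 + x) powr p + (1 - x) powr p) / 2)"
    by simp
  have "x\<^sup>2 < 1" using assms(3) by (simp add: abs_square_less_1)
  then have "(1 - p) * x\<^sup>2 < 1"
    using assms(1,2) mult_le_one[of "1 - p" "x\<^sup>2"]
    by (smt (verit) mult_left_le mult_left_le_one_le zero_le_power2)
  then have "\<bar>- ((1 - p) * x\<^sup>2)\<bar> < 1"
    using assms by (simp add: abs_mult)
  from gen_binomial_real[OF this, of "p / 2"]
  show "(\<lambda>k. (p / 2 gchoose k) * (- ((1 - p) * x\<^sup>2)) ^ k) sums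
      (1 - (1 - p) * x\<^sup>2) powr (p / 2)"
    by simp
qed

text \<open>The endpoints \<open>x = 1\<close> and \<open>x = -1\<close>, which lie on the circle of convergence, are reached by
  continuity. They matter because indicator functions vanish at some vertices.\<close>

lemma power_mean_le:
  fixes p x :: real
  assumes p: "0 < p" "p < 1" and x: "\<bar>x\<bar> \<le> 1"
  shows "((1 + x) powr p + (1 - x) powr p) / 2 \<le> (1 - (1 - p) * x\<^sup>2) powr (p / 2)"
proof (rule tendsto_le)
  define y where "y m = (real m / real (Suc m)) * x" for m
  have y_lim: "y \<longlonglongrightarrow> x"
    using tendsto_mult[OF LIMSEQ_n_over_Suc_n tendsto_const[of x]] by (simp add: y_def[abs_def])
  have y_less: "\<bar>y m\<bar> < 1" for m
  proof -
    have "\<bar>y m\<bar> \<le> real m / real (Suc m)"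
      using mult_left_mono[OF x, of "real m / real (Suc m)"] by (simp add: y_def abs_mult)
    also have "\<dots> < 1" by simp
    finally show ?thesis .
  qed
  have pos: "0 \<le> 1 - (1 - p) * z\<^sup>2" if "\<bar>z\<bar> < 1" for z
    using p that mult_le_one[of "1 - p" "z\<^sup>2"] by (simp add: abs_square_le_1 less_imp_le)
  show "\<forall>\<^sub>F m in sequentially. ((1 + y m) powr p + (1 - y m) powr p) / 2
      \<le> (1 - (1 - p) * (y m)\<^sup>2) powr (p / 2)"
    using power_mean_le_open[OF p y_less] by simp
  show "(\<lambda>m. (1 - (1 - p) * (y m)\<^sup>2) powr (p / 2)) \<longlonglongrightarrow> (1 - (1 - p) * x\<^sup>2) powr (p / 2)"
    using p pos y_less by (intro tendsto_powr' tendsto_intros y_lim) auto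
  have "0 \<le> 1 + y m" "0 \<le> 1 - y m" for m using y_less[of m] by auto
  then show "(\<lambda>m. ((1 + y m) powr p + (1 - y m) powr p) / 2)
      \<longlonglongrightarrow> ((1 + x) powr p + (1 - x) powr p) / 2"
    using p by (intro tendsto_powr' tendsto_intros y_lim) auto
qed auto

text \<open>The homogeneous form of the previous bound: a function on two points with mean \<open>c\<close> and
  half-difference \<open>d\<close> has \<open>p\<close>-norm at most the square root of \<open>c\<^sup>2 - (1 - p) d\<^sup>2\<close>.\<close>

lemma two_point_norm_le:
  fixes p u v :: real
  assumes p: "0 < p" "p < 1" and uv: "0 \<le> u" "0 \<le> v"
  shows "((u powr p + v powr p) / 2) powr (1 / p)
    \<le> sqrt (((u + v) / 2)\<^sup>2 - (1 - p) * ((u - v) / 2)\<^sup>2)"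
proof (cases "u + v = 0")
  case True
  then have "u = 0" "v = 0" using uv by auto
  then show ?thesis using p by simp
next
  case False
  define c x where "c = (u + v) / 2" and "x = (u - v) / (u + v)"
  have c: "0 < c" using False uv by (simp add: c_def)
  have u: "u = c * (1 + x)" and v: "v = c * (1 - x)"
    using False by (simp_all add: c_def x_def divide_simps) 
  have x: "\<bar>x\<bar> \<le> 1" using False uv by (simp add: x_def divide_simps)
  have nn: "0 \<le> 1 - (1 - p) * x\<^sup>2"
    using p x mult_le_one[of "1 - p" "x\<^sup>2"] by (simp add: abs_square_le_1)
  have "(c * (1 + x)) powr p = c powr p * (1 + x) powr p"
    and "(c * (1 - x)) powr p = c powr p * (1 - x) powr p"
    using c x by (auto intro!: powr_mult)
  then have "((u powr p + v powr p) / 2) powr (1 / p)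
      = (c powr p * (((1 + x) powr p + (1 - x) powr p) / 2)) powr (1 / p)"
    by (simp only: u v distrib_left add_divide_distrib times_divide_eq_right)
  also have "\<dots> \<le> (c powr p * (1 - (1 - p) * x\<^sup>2) powr (p / 2)) powr (1 / p)"
    using p power_mean_le[OF p x] by (intro powr_mono2 mult_left_mono) auto
  also have "\<dots> = c * sqrt (1 - (1 - p) * x\<^sup>2)"
    using c p nn by (simp add: powr_mult powr_powr powr_half_sqrt)
  also have "\<dots> = sqrt (c\<^sup>2 * (1 - (1 - p) * x\<^sup>2))"
    using c by (simp add: real_sqrt_mult)
  also have "c\<^sup>2 * (1 - (1 - p) * x\<^sup>2) = ((u + v) / 2)\<^sup>2 - (1 - p) * ((u - v) / 2)\<^sup>2"
    unfolding u v by (simp add: power2_eq_square algebra_simps)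
  finally show ?thesis .
qed

text \<open>In terms of the means \<open>c, c'\<close> and half-differences \<open>d, d'\<close> of the two functions, the right
  side is \<open>2 (c c' + \<rho> d d')\<close>. The product of the two norm bounds is at most \<open>c c' - \<rho> \<bar>d d'\<bar>\<close>:
  after squaring and inserting \<open>(1 - p) (1 - q) = \<rho>\<^sup>2\<close>, this is the inequality between the
  arithmetic and geometric means of \<open>(1 - p) d\<^sup>2 c'\<^sup>2\<close> and \<open>(1 - q) c\<^sup>2 d'\<^sup>2\<close>.\<close>

lemma two_point_reverse_hypercontractive:
  fixes \<rho> p q u v w z :: real
  assumes \<rho>: "0 \<le> \<rho>" and p: "0 < p" "p < 1" and q: "0 < q" "q < 1"
    and pq: "(1 - p) * (1 - q) = \<rho>\<^sup>2"
    and nonneg: "0 \<le> u" "0 \<le> v" "0 \<le> w" "0 \<le> z"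
  shows "2 * (((u powr p + v powr p) / 2) powr (1 / p) * ((w powr q + z powr q) / 2) powr (1 / q))
    \<le> (1 + \<rho>) / 2 * (u * w + v * z) + (1 - \<rho>) / 2 * (u * z + v * w)"
proof -
  define c d c' d' where "c = (u + v) / 2" and "d = (u - v) / 2"
    and "c' = (w + z) / 2" and "d' = (w - z) / 2"
  define A B where "A = (1 - p) * (d\<^sup>2 * c'\<^sup>2)" and "B = (1 - q) * (c\<^sup>2 * d'\<^sup>2)"
  have "\<rho>\<^sup>2 < 1"
    using p q mult_strict_mono'[of "1 - p" 1 "1 - q" 1] pq by simp
  then have \<rho>1: "\<rho> \<le> 1" using \<rho> by (simp add: abs_square_less_1)
  have cd: "\<bar>d\<bar> \<le> c" "\<bar>d'\<bar> \<le> c'" using nonneg by (auto simp: c_def d_def c'_def d'_def)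
  have nn: "0 \<le> c * c' - \<rho> * (\<bar>d\<bar> * \<bar>d'\<bar>)"
  proof -
    have "\<rho> * (\<bar>d\<bar> * \<bar>d'\<bar>) \<le> 1 * (c * c')"
      using \<rho> \<rho>1 cd by (intro mult_mono) auto
    then show ?thesis by simp
  qed
  have "(2 * \<rho> * (\<bar>d\<bar> * \<bar>d'\<bar>) * (c * c'))\<^sup>2 = 4 * A * B"
    unfolding A_def B_def by (simp add: power_mult_distrib pq[symmetric])
  also have "\<dots> \<le> (A + B)\<^sup>2"
    using zero_le_power2[of "A - B"] by (simp add: power2_eq_square algebra_simps)
  finally have "(2 * \<rho> * (\<bar>d\<bar> * \<bar>d'\<bar>) * (c * c'))\<^sup>2 \<le> (A + B)\<^sup>2" .
  then have amgm: "2 * \<rho> * (\<bar>d\<bar> * \<bar>d'\<bar>) * (c * c') \<le> A + B"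
    by (rule power2_le_imp_le) (use p q in \<open>simp add: A_def B_def\<close>)
  have "(c\<^sup>2 - (1 - p) * d\<^sup>2) * (c'\<^sup>2 - (1 - q) * d'\<^sup>2)
      = (c * c')\<^sup>2 - (A + B) + ((1 - p) * (1 - q)) * (d * d')\<^sup>2"
    unfolding A_def B_def by (simp add: power_mult_distrib algebra_simps)
  also have "\<dots> = (c * c')\<^sup>2 - (A + B) + (\<rho> * (\<bar>d\<bar> * \<bar>d'\<bar>))\<^sup>2"
    by (simp add: pq power_mult_distrib)
  also have "\<dots> \<le> (c * c')\<^sup>2 - 2 * \<rho> * (\<bar>d\<bar> * \<bar>d'\<bar>) * (c * c') + (\<rho> * (\<bar>d\<bar> * \<bar>d'\<bar>))\<^sup>2"
    using amgm by simp
  also have "\<dots> = (c * c' - \<rho> * (\<bar>d\<bar> * \<bar>d'\<bar>))\<^sup>2"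
    by (simp add: power2_eq_square algebra_simps)
  finally have "sqrt ((c\<^sup>2 - (1 - p) * d\<^sup>2) * (c'\<^sup>2 - (1 - q) * d'\<^sup>2)) \<le> c * c' - \<rho> * (\<bar>d\<bar> * \<bar>d'\<bar>)"
    using nn by (intro real_le_lsqrt) auto
  moreover have "((u powr p + v powr p) / 2) powr (1 / p) * ((w powr q + z powr q) / 2) powr (1 / q)
      \<le> sqrt (c\<^sup>2 - (1 - p) * d\<^sup>2) * sqrt (c'\<^sup>2 - (1 - q) * d'\<^sup>2)"
  proof (intro mult_mono)
    show "((u powr p + v powr p) / 2) powr (1 / p) \<le> sqrt (c\<^sup>2 - (1 - p) * d\<^sup>2)"
      using two_point_norm_le[OF p nonneg(1,2)] by (simp add: c_def d_def)
    then show "0 \<le> sqrt (c\<^sup>2 - (1 - p) * d\<^sup>2)"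
      by (rule order_trans[rotated]) simp
    show "((w powr q + z powr q) / 2) powr (1 / q) \<le> sqrt (c'\<^sup>2 - (1 - q) * d'\<^sup>2)"
      using two_point_norm_le[OF q nonneg(3,4)] by (simp add: c'_def d'_def)
  qed simp
  moreover have "- (d * d') \<le> \<bar>d\<bar> * \<bar>d'\<bar>"
    by (metis abs_ge_minus_self abs_mult)
  then have "c * c' - \<rho> * (\<bar>d\<bar> * \<bar>d'\<bar>) \<le> c * c' + \<rho> * (d * d')"
    using mult_left_mono[of "- (d * d')" "\<bar>d\<bar> * \<bar>d'\<bar>" \<rho>] \<rho> by simp
  moreover have "(1 + \<rho>) / 2 * (u * w + v * z) + (1 - \<rho>) / 2 * (u * z + v * w)
      = 2 * (c * c' + \<rho> * (d * d'))"
    by (simp add: c_def d_def c'_def d'_def field_simps)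
  ultimately show ?thesis
    by (simp add: real_sqrt_mult)
qed

section \<open>Tensorization over the cube\<close>

text \<open>The transition matrix of the noise operator: the coordinates of \<open>y\<close> are independent, and
  each has correlation \<open>\<rho>\<close> with the corresponding coordinate of \<open>x\<close>.\<close>

definition noise_kernel :: "real \<Rightarrow> nat \<Rightarrow> (nat \<Rightarrow> int) \<Rightarrow> (nat \<Rightarrow> int) \<Rightarrow> real" where
  "noise_kernel \<rho> n x y = (\<Prod>i\<in>{1..n}. (1 + \<rho> * (of_int (x i) * of_int (y i))) / 2)"

text \<open>The norm is taken with respect to the uniform probability measure. For \<open>p < 1\<close> it is not a norm
  in the usual sense, but it can still be computed one coordinate at a time, which is what the
  induction on the dimension uses.\<close>

definition cube_norm :: "nat \<Rightarrow> real \<Rightarrow> ((nat \<Rightarrow> int) \<Rightarrow> real) \<Rightarrow> real" where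
  "cube_norm n p f = ((\<Sum>x\<in>cube n. f x powr p) / 2 ^ n) powr (1 / p)"

lemma sum_cube_Suc:
  "(\<Sum>x\<in>cube (Suc n). h x) = (\<Sum>x\<in>cube n. h (x(Suc n := 1)) + h (x(Suc n := - 1)))"
proof -
  have "cube (Suc n) = (\<lambda>(e, x). x(Suc n := e)) ` ({-1, 1} \<times> cube n)"
    unfolding cube_def by (simp add: atLeastAtMostSuc_conv PiE_insert_eq)
  moreover have "inj_on (\<lambda>(e, x). x(Suc n := e)) ({-1, 1 :: int} \<times> cube n)"
    unfolding cube_def by (rule inj_combinator) simp
  ultimately have "(\<Sum>x\<in>cube (Suc n). h x)
      = (\<Sum>(e, x)\<in>{-1, 1} \<times> cube n. h (x(Suc n := e)))"
    by (simp add: sum.reindex case_prod_unfold o_def)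
  also have "\<dots> = (\<Sum>e\<in>{-1, 1}. \<Sum>x\<in>cube n. h (x(Suc n := e)))"
    by (simp add: sum.cartesian_product)
  finally show ?thesis
    by (simp add: sum.distrib add.commute)
qed

lemma noise_kernel_Suc:
  "noise_kernel \<rho> (Suc n) (x(Suc n := a)) (y(Suc n := b)) =
    noise_kernel \<rho> n x y * ((1 + \<rho> * (of_int a * of_int b)) / 2)"
  unfolding noise_kernel_def by (simp add: prod.nat_ivl_Suc')

lemma noise_kernel_sum:
  assumes "x \<in> cube n"
  shows "(\<Sum>y\<in>cube n. noise_kernel \<rho> n x y) = 1"
proof -
  have "(\<Sum>y\<in>cube n. noise_kernel \<rho> n x y)
      = (\<Prod>i\<in>{1..n}. \<Sum>e\<in>{-1, 1 :: int}. (1 + \<rho> * (of_int (x i) * of_int e)) / 2)"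
    unfolding noise_kernel_def cube_def by (subst prod_sum_PiE) auto
  then show ?thesis
    by (simp add: field_simps)
qed

lemma cube_norm_nonneg: "0 \<le> cube_norm n p f"
  by (simp add: cube_norm_def)

lemma cube_norm_Suc:
  assumes "p > 0"
  shows "cube_norm (Suc n) p f =
    ((cube_norm n p (\<lambda>x. f (x(Suc n := 1))) powr p
      + cube_norm n p (\<lambda>x. f (x(Suc n := - 1))) powr p) / 2) powr (1 / p)"
  using assms
  by (simp add: cube_norm_def powr_powr sum_nonneg sum_cube_Suc sum.distrib add_divide_distrib mult.commute)

text \<open>Borell's reverse hypercontractive inequality in its two-function form. This form tensorizes
  directly: the induction hypothesis bounds the contribution of each pair of values of the last
  coordinate by a product of norms, and the two-point inequality is then applied to these norms as
  functions of that coordinate.\<close>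

theorem reverse_hypercontractive:
  fixes f g :: "(nat \<Rightarrow> int) \<Rightarrow> real"
  assumes \<rho>: "0 \<le> \<rho>" and p: "0 < p" "p < 1" and q: "0 < q" "q < 1"
    and pq: "(1 - p) * (1 - q) = \<rho>\<^sup>2"
    and f: "\<And>x. 0 \<le> f x" and g: "\<And>x. 0 \<le> g x"
  shows "2 ^ n * (cube_norm n p f * cube_norm n q g)
    \<le> (\<Sum>x\<in>cube n. \<Sum>y\<in>cube n. f x * noise_kernel \<rho> n x y * g y)"
  using f g
proof (induction n arbitrary: f g)
  case 0
  then show ?case
    using p q by (simp add: cube_norm_def noise_kernel_def cube_def powr_powr)
next
  case (Suc n)
  have "\<rho>\<^sup>2 < 1"
    using p q mult_strict_mono'[of "1 - p" 1 "1 - q" 1] pq by simp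
  then have \<rho>1: "\<rho> \<le> 1" using \<rho> by (simp add: abs_square_less_1)
  define F G where "F a x = f (x(Suc n := a))" and "G a x = g (x(Suc n := a))" for a x
  define B where "B a b = (\<Sum>x\<in>cube n. \<Sum>y\<in>cube n. F a x * noise_kernel \<rho> n x y * G b y)" for a b
  have IH: "2 ^ n * (cube_norm n p (F a) * cube_norm n q (G b)) \<le> B a b" for a b
    unfolding B_def by (rule Suc.IH) (auto simp: F_def G_def Suc.prems)
  let ?N = "\<lambda>a. cube_norm n p (F a)" and ?M = "\<lambda>b. cube_norm n q (G b)"
  have "2 ^ Suc n * (cube_norm (Suc n) p f * cube_norm (Suc n) q g)
      = 2 ^ n * (2 * (((?N 1 powr p + ?N (-1) powr p) / 2) powr (1 / p)
          * ((?M 1 powr q + ?M (-1) powr q) / 2) powr (1 / q)))"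
    using p q by (simp add: cube_norm_Suc F_def[abs_def] G_def[abs_def])
  also have "\<dots> \<le> 2 ^ n * ((1 + \<rho>) / 2 * (?N 1 * ?M 1 + ?N (-1) * ?M (-1))
      + (1 - \<rho>) / 2 * (?N 1 * ?M (-1) + ?N (-1) * ?M 1))"
    by (intro mult_left_mono two_point_reverse_hypercontractive \<rho> p q pq cube_norm_nonneg) simp
  also have "\<dots> = (1 + \<rho>) / 2 * (2 ^ n * (?N 1 * ?M 1) + 2 ^ n * (?N (-1) * ?M (-1)))
      + (1 - \<rho>) / 2 * (2 ^ n * (?N 1 * ?M (-1)) + 2 ^ n * (?N (-1) * ?M 1))"
    by (simp add: algebra_simps)
  also have "\<dots> \<le> (1 + \<rho>) / 2 * (B 1 1 + B (-1) (-1)) + (1 - \<rho>) / 2 * (B 1 (-1) + B (-1) 1)"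
    using \<rho> \<rho>1 by (intro add_mono mult_left_mono IH) auto
  also have "\<dots> = (\<Sum>x\<in>cube (Suc n). \<Sum>y\<in>cube (Suc n). f x * noise_kernel \<rho> (Suc n) x y * g y)"
    unfolding sum_cube_Suc noise_kernel_Suc B_def F_def G_def
    by (simp add: sum.distrib sum_distrib_left algebra_simps add_divide_distrib diff_divide_distrib
        sum_subtractf)
  finally show ?case .
qed

text \<open>For indicator functions, raising to the power \<open>p > 0\<close> changes nothing, so the norms are
  powers of the fractional sizes.\<close>

corollary noise_kernel_sets_ge:
  assumes \<rho>: "0 \<le> \<rho>" and p: "0 < p" "p < 1" and q: "0 < q" "q < 1"
    and pq: "(1 - p) * (1 - q) = \<rho>\<^sup>2"
    and S: "S \<subseteq> cube n" and T: "T \<subseteq> cube n"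
  shows "2 ^ n * ((card S / 2 ^ n) powr (1 / p) * (card T / 2 ^ n) powr (1 / q))
    \<le> (\<Sum>x\<in>S. \<Sum>y\<in>T. noise_kernel \<rho> n x y)"
proof -
  have norm: "cube_norm n r (indicator A) = (card A / 2 ^ n) powr (1 / r)"
    if "A \<subseteq> cube n" "0 < r" for A r
  proof -
    have "(\<Sum>x\<in>cube n. indicator A x powr r) = (\<Sum>x\<in>cube n. indicator A x :: real)"
      using that by (intro sum.cong) (auto simp: indicator_def)
    also have "\<dots> = card A"
      using that by (simp add: sum.If_cases indicator_def finite_cube Int_absorb1)
    finally show ?thesis by (simp add: cube_norm_def)
  qed
  have "2 ^ n * ((card S / 2 ^ n) powr (1 / p) * (card T / 2 ^ n) powr (1 / q))
      \<le> (\<Sum>x\<in>cube n. \<Sum>y\<in>cube n. indicator S x * noise_kernel \<rho> n x y * indicator T y)"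
    using reverse_hypercontractive[OF \<rho> p q pq, of "indicator S" "indicator T" n] S T p q
    by (simp add: norm)
  also have "\<dots> = (\<Sum>x\<in>cube n. indicator S x * (\<Sum>y\<in>cube n. indicator T y * noise_kernel \<rho> n x y))"
    by (simp add: sum_distrib_left mult_ac)
  also have "\<dots> = (\<Sum>x\<in>S. \<Sum>y\<in>T. noise_kernel \<rho> n x y)"
  proof -
    have "{x \<in> cube n. x \<in> S} = S" "{y \<in> cube n. y \<in> T} = T" using S T by auto
    then show ?thesis by (simp add: finite_cube indicator_def sum.If_cases Int_def)
  qed
  finally show ?thesis .
qed

text \<open>Writing \<open>1 - p = \<rho> r\<close> and \<open>1 - q = \<rho>/r\<close>, the exponent \<open>1/p + \<alpha>/q\<close> given by reverse
  hypercontractivity is least at \<open>r = (s + \<rho>)/(1 + s \<rho>)\<close> with \<open>s\<close> the square root of \<open>\<alpha>\<close>, where it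
  equals \<open>(s + \<rho>)\<^sup>2 / (1 - \<rho>\<^sup>2) + 1\<close>; conditioning on the starting set removes the
  summand 1.\<close>

theorem noise_kernel_sets_ge_powr:
  fixes \<sigma> \<alpha> \<rho> :: real
  assumes \<rho>: "0 < \<rho>" "\<rho> < 1" and S: "S \<subseteq> cube n" "S \<noteq> {}" and T: "T \<subseteq> cube n"
    and \<sigma>: "\<sigma> = card S / 2 ^ n" and \<alpha>: "0 \<le> \<alpha>" "card T / 2 ^ n = \<sigma> powr \<alpha>"
  shows "\<sigma> powr ((sqrt \<alpha> + \<rho>)\<^sup>2 / (1 - \<rho>\<^sup>2))
    \<le> (\<Sum>x\<in>S. \<Sum>y\<in>T. noise_kernel \<rho> n x y) / card S"
proof -
  have fin: "finite S" "finite T" using S T finite_cube finite_subset by blast+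
  have cS: "0 < card S" using fin S by (simp add: card_gt_0_iff)
  have \<sigma>0: "0 < \<sigma>" using cS \<sigma> by simp
  have "card S \<le> 2 ^ n" using card_mono[OF finite_cube S(1)] by (simp add: card_cube)
  then have "real (card S) \<le> real (2 ^ n)" by (rule of_nat_mono)
  then have \<sigma>1: "\<sigma> \<le> 1" using \<sigma> by simp
  have \<rho>2: "\<rho>\<^sup>2 < 1" using \<rho> by (simp add: abs_square_less_1)
  show ?thesis
  proof (cases "\<alpha> = 0")
    \<comment> \<open>The optimal \<open>q\<close> degenerates to 0, but then \<open>T\<close> is the whole cube and the noise ends there surely.\<close>
    case True
    then have "card T = card (cube n)"
      using \<alpha> \<sigma>0 by (simp add: card_cube)
    then have "T = cube n" using T finite_cube by (simp add: card_subset_eq)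
    then have "(\<Sum>x\<in>S. \<Sum>y\<in>T. noise_kernel \<rho> n x y) = (\<Sum>x\<in>S. 1)"
      using S by (intro sum.cong) (auto simp: noise_kernel_sum)
    moreover have "\<sigma> powr ((sqrt \<alpha> + \<rho>)\<^sup>2 / (1 - \<rho>\<^sup>2)) \<le> 1"
      using \<sigma>0 \<sigma>1 \<rho>2 by (intro powr_le1) auto
    ultimately show ?thesis using cS by simp
  next
    case False
    define s where "s = sqrt \<alpha>"
    have s: "0 < s" "\<alpha> = s\<^sup>2" using False \<alpha>(1) by (auto simp: s_def)
    \<comment> \<open>These are \<open>1 - \<rho> r\<close> and \<open>1 - \<rho>/r\<close> for the optimal \<open>r\<close>.\<close>
    define p where "p = (1 - \<rho>\<^sup>2) / (1 + s * \<rho>)"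
    define q where "q = s * (1 - \<rho>\<^sup>2) / (s + \<rho>)"
    have d: "0 < 1 + s * \<rho>" "0 < s + \<rho>" "0 < 1 - \<rho>\<^sup>2" using s \<rho> \<rho>2 by (auto intro: add_pos_pos)
    have "\<rho>\<^sup>2 > 0" "s * \<rho> > 0" "s * \<rho>\<^sup>2 > 0" using s \<rho> by auto
    then have p: "0 < p" "p < 1" and q: "0 < q" "q < 1"
      using d s \<rho> by (auto simp: p_def q_def divide_simps algebra_simps add_pos_pos)
    have "1 - p = \<rho> * (s + \<rho>) / (1 + s * \<rho>)"
      using d by (simp add: p_def field_simps power2_eq_square)
    moreover have "1 - q = \<rho> * (1 + s * \<rho>) / (s + \<rho>)"
      using d by (simp add: q_def field_simps power2_eq_square)
    ultimately have pq: "(1 - p) * (1 - q) = \<rho>\<^sup>2"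
      using d by (simp add: power2_eq_square)
    have expo: "1 / p + \<alpha> * (1 / q) = (s + \<rho>)\<^sup>2 / (1 - \<rho>\<^sup>2) + 1"
    proof -
      have "\<alpha> * (1 / q) = s * (s + \<rho>) / (1 - \<rho>\<^sup>2)" "1 / p = (1 + s * \<rho>) / (1 - \<rho>\<^sup>2)"
        using s by (simp_all add: p_def q_def power2_eq_square)
      then have "1 / p + \<alpha> * (1 / q) = (1 + s * \<rho> + s * (s + \<rho>)) / (1 - \<rho>\<^sup>2)"
        by (simp add: add_divide_distrib)
      also have "1 + s * \<rho> + s * (s + \<rho>) = (s + \<rho>)\<^sup>2 + (1 - \<rho>\<^sup>2)"
        by (simp add: power2_eq_square algebra_simps)
      finally show ?thesis
        using d by (simp add: add_divide_distrib)
    qed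
    have "\<sigma> powr ((s + \<rho>)\<^sup>2 / (1 - \<rho>\<^sup>2)) * \<sigma> = \<sigma> powr (1 / p) * (\<sigma> powr \<alpha>) powr (1 / q)"
    proof -
      have "\<sigma> powr (1 / p) * (\<sigma> powr \<alpha>) powr (1 / q) = \<sigma> powr (1 / p + \<alpha> * (1 / q))"
        by (simp only: powr_powr powr_add)
      also have "\<dots> = \<sigma> powr ((s + \<rho>)\<^sup>2 / (1 - \<rho>\<^sup>2)) * \<sigma>"
        using \<sigma>0 by (simp only: expo powr_add) simp
      finally show ?thesis ..
    qed
    also have "2 ^ n * \<dots> \<le> (\<Sum>x\<in>S. \<Sum>y\<in>T. noise_kernel \<rho> n x y)"
      using noise_kernel_sets_ge[OF less_imp_le[OF \<rho>(1)] p q pq S(1) T] by (simp add: \<sigma>[symmetric] \<alpha>)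
    finally have "2 ^ n * (\<sigma> powr ((s + \<rho>)\<^sup>2 / (1 - \<rho>\<^sup>2)) * \<sigma>)
        \<le> (\<Sum>x\<in>S. \<Sum>y\<in>T. noise_kernel \<rho> n x y)" .
    moreover have "2 ^ n * (\<sigma> powr e * \<sigma>) = \<sigma> powr e * card S" for e
      by (simp add: \<sigma>)
    ultimately show ?thesis
      using cS by (simp add: s_def pos_le_divide_eq)
  qed
qed

section \<open>Fourier expansion of the walk\<close>

definition character :: "nat set \<Rightarrow> (nat \<Rightarrow> int) \<Rightarrow> real" where
  "character A x = (\<Prod>i\<in>A. of_int (x i))"

text \<open>The matrix of the operator that multiplies every character of degree \<open>k\<close> by \<open>c k\<close>. Both the
  noise operator and the powers of the walk have this form.\<close>

definition fourier_kernel :: "nat \<Rightarrow> (nat \<Rightarrow> real) \<Rightarrow> (nat \<Rightarrow> int) \<Rightarrow> (nat \<Rightarrow> int) \<Rightarrow> real" where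
  "fourier_kernel n c x y =
    (\<Sum>A\<in>Pow {1..n}. c (card A) * (character A x * character A y)) / 2 ^ n"

lemma noise_kernel_fourier: "noise_kernel \<rho> n x y = fourier_kernel n (\<lambda>k. \<rho> ^ k) x y"
proof -
  have "(\<Prod>i\<in>{1..n}. \<rho> * (of_int (x i) * of_int (y i)) + 1)
      = (\<Sum>A\<in>Pow {1..n}. \<rho> ^ card A * (character A x * character A y))"
    by (subst prod_add) (simp_all add: character_def prod.distrib)
  then show ?thesis
    by (simp add: noise_kernel_def fourier_kernel_def prod_dividef add.commute)
qed

text \<open>Together with the Fourier expansion, the case \<open>\<rho> = 1\<close> is the completeness of the characters.\<close>

lemma noise_kernel_1:
  assumes "x \<in> cube n" "y \<in> cube n"
  shows "noise_kernel 1 n x y = (if x = y then 1 else 0)"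
proof (cases "x = y")
  case True
  have "x i * x i = 1" if "i \<in> {1..n}" for i
  proof -
    have "x i \<in> {-1, 1}" using assms(1) that unfolding cube_def by (rule PiE_mem)
    then show ?thesis by auto
  qed
  then have "of_int (x i) * of_int (x i) = (1 :: real)" if "i \<in> {1..n}" for i
    using that by (metis of_int_1 of_int_mult)
  then show ?thesis using True by (simp add: noise_kernel_def)
next
  case False
  then obtain i where i: "i \<in> {1..n}" "x i \<noteq> y i"
    using assms unfolding cube_def by (metis PiE_ext)
  moreover have "x i \<in> {-1, 1}" "y i \<in> {-1, 1}"
    by (rule PiE_mem[OF assms(1)[unfolded cube_def] i(1)],
        rule PiE_mem[OF assms(2)[unfolded cube_def] i(1)])
  ultimately have "x i * y i = - 1" by auto
  then have "of_int (x i) * of_int (y i) = (- 1 :: real)"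
    by (metis of_int_1 of_int_minus of_int_mult)
  then show ?thesis using False i by (auto simp: noise_kernel_def intro!: prod_zero bexI[of _ i])
qed

lemma flip_flip: "flip i (flip i x) = x"
  by (simp add: flip_def)

lemma character_flip:
  assumes "finite A"
  shows "character A (flip i y) = (if i \<in> A then - 1 else 1) * character A y"
proof (cases "i \<in> A")
  case True
  have "(\<Prod>j\<in>A - {i}. of_int (flip i y j)) = (\<Prod>j\<in>A - {i}. real_of_int (y j))"
    by (intro prod.cong) (auto simp: flip_def)
  then show ?thesis
    using True assms by (simp add: character_def prod.remove flip_def)
next
  case False
  then show ?thesis
    by (auto simp: character_def flip_def intro!: prod.cong)
qed

text \<open>A character of degree \<open>k\<close> changes sign for \<open>k\<close> of the \<open>n\<close> coordinate flips, so it is an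
  eigenfunction of one lazy step with eigenvalue \<open>1/2 + (n - 2k)/(2n) = 1 - k/n\<close>.\<close>

lemma character_step:
  assumes "n \<ge> 1" "A \<subseteq> {1..n}"
  shows "character A y / 2 + (\<Sum>i\<in>{1..n}. character A (flip i y)) / (2 * real n)
    = (1 - card A / n) * character A y"
proof -
  have fin: "finite A" using assms(2) finite_subset by blast
  have "(\<Sum>i\<in>{1..n}. if i \<in> A then - 1 else 1 :: real) = - real (card A) + card ({1..n} - A)"
    using assms(2) by (simp add: sum.If_cases Int_absorb1 Diff_eq)
  also have "\<dots> = real n - 2 * card A"
    using assms(2) card_mono[OF _ assms(2)] fin by (simp add: card_Diff_subset of_nat_diff)
  finally have "(\<Sum>i\<in>{1..n}. character A (flip i y)) = (real n - 2 * card A) * character A y"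
    using fin by (simp add: character_flip flip: sum_distrib_right)
  moreover have "c / 2 + (real n - 2 * k) * c / (2 * real n) = (1 - k / n) * c" for c k :: real
    using assms(1) by (simp add: field_simps)
  ultimately show ?thesis by simp
qed

text \<open>Choosing the coordinate to flip before looking at the current position turns a step into
  a mixture of bijections of the cube; each flip is its own inverse.\<close>

lemma pmf_walk_Suc:
  assumes "n \<ge> 1"
  shows "pmf (walk n \<mu> (Suc t)) y =
    pmf (walk n \<mu> t) y / 2 + (\<Sum>i\<in>{1..n}. pmf (walk n \<mu> t) (flip i y)) / (2 * real n)"
proof -
  let ?M = "walk n \<mu> t"
  have ne: "{1..n} \<noteq> {}" using assms by simp
  have inj: "pmf (map_pmf (flip i) ?M) y = pmf ?M (flip i y)" for i
    using pmf_map_inj'[of "flip i" ?M "flip i y"] by (metis flip_flip injI)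
  have "walk n \<mu> (Suc t) = bind_pmf (bernoulli_pmf (1 / 2)) (\<lambda>stay. bind_pmf ?M
      (\<lambda>x. if stay then return_pmf x else map_pmf (\<lambda>i. flip i x) (pmf_of_set {1..n})))"
    by (simp add: walk_step_def[abs_def]) (rule bind_commute_pmf)
  also have "\<dots> = bind_pmf (bernoulli_pmf (1 / 2)) (\<lambda>stay. if stay then ?M
      else bind_pmf (pmf_of_set {1..n}) (\<lambda>i. map_pmf (flip i) ?M))"
  proof (intro bind_pmf_cong refl)
    fix stay
    have "bind_pmf ?M (\<lambda>x. map_pmf (\<lambda>i. flip i x) (pmf_of_set {1..n}))
        = bind_pmf (pmf_of_set {1..n}) (\<lambda>i. map_pmf (flip i) ?M)"
      unfolding map_pmf_def by (rule bind_commute_pmf)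
    then show "bind_pmf ?M
        (\<lambda>x. if stay then return_pmf x else map_pmf (\<lambda>i. flip i x) (pmf_of_set {1..n}))
        = (if stay then ?M else bind_pmf (pmf_of_set {1..n}) (\<lambda>i. map_pmf (flip i) ?M))"
      by (simp add: bind_return_pmf')
  qed
  finally show ?thesis
    using ne by (simp add: pmf_bind[of "bernoulli_pmf _"] pmf_bind_pmf_of_set inj)
qed

text \<open>For \<open>t = 0\<close> this is completeness of the characters; each further step multiplies the
  characters by their eigenvalues.\<close>

lemma pmf_walk_fourier:
  assumes n: "n \<ge> 1" and S: "S \<subseteq> cube n" "S \<noteq> {}" and y: "y \<in> cube n"
  shows "pmf (walk n (pmf_of_set S) t) y
    = (\<Sum>x\<in>S. fourier_kernel n (\<lambda>k. (1 - k / n) ^ t) x y) / card S"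
  using y
proof (induction t arbitrary: y)
  case 0
  have fin: "finite S" using S finite_cube finite_subset by blast
  have "(\<Sum>x\<in>S. fourier_kernel n (\<lambda>k. 1 ^ k) x y) = (\<Sum>x\<in>S. if x = y then 1 else 0)"
    using S 0 by (intro sum.cong refl, subst noise_kernel_fourier[symmetric]) (auto simp: noise_kernel_1)
  then show ?case
    using fin S by (simp add: indicator_def)
next
  case (Suc t)
  let ?c = "\<lambda>t k. (1 - real k / real n) ^ t"
  have step: "fourier_kernel n (?c (Suc t)) x y = fourier_kernel n (?c t) x y / 2
      + (\<Sum>i\<in>{1..n}. fourier_kernel n (?c t) x (flip i y)) / (2 * real n)" for x
  proof -
    have "(\<Sum>A\<in>Pow {1..n}. ?c (Suc t) (card A) * (character A x * character A y))
        = (\<Sum>A\<in>Pow {1..n}. ?c t (card A) * character A x * ((1 - card A / n) * character A y))"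
      by (simp add: mult_ac)
    also have "\<dots> = (\<Sum>A\<in>Pow {1..n}. ?c t (card A) * character A x *
        (character A y / 2 + (\<Sum>i\<in>{1..n}. character A (flip i y)) / (2 * real n)))"
      using character_step[OF n] by (intro sum.cong) auto
    also have "\<dots> = (\<Sum>A\<in>Pow {1..n}. ?c t (card A) * (character A x * character A y)) / 2
        + (\<Sum>i\<in>{1..n}. \<Sum>A\<in>Pow {1..n}. ?c t (card A) * (character A x * character A (flip i y)))
          / (2 * real n)"
      by (subst sum.swap)
        (simp add: sum.distrib sum_distrib_left sum_divide_distrib distrib_left mult_ac)
    finally show ?thesis
      unfolding fourier_kernel_def by (simp add: add_divide_distrib sum_divide_distrib mult_ac)
  qed
  have "pmf (walk n (pmf_of_set S) (Suc t)) y
      = (\<Sum>x\<in>S. fourier_kernel n (?c t) x y) / card S / 2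
        + (\<Sum>i\<in>{1..n}. (\<Sum>x\<in>S. fourier_kernel n (?c t) x (flip i y)) / card S) / (2 * real n)"
    using Suc flip_in_cube by (simp add: pmf_walk_Suc[OF n] del: walk.simps)
  also have "\<dots> = (\<Sum>x\<in>S. fourier_kernel n (?c (Suc t)) x y) / card S"
    unfolding step by (simp add: sum.distrib add_divide_distrib sum_divide_distrib mult_ac
      sum.swap[of _ S])
  finally show ?case .
qed

lemma walk_prob_fourier:
  assumes "n \<ge> 1" and S: "S \<subseteq> cube n" "S \<noteq> {}" and T: "T \<subseteq> cube n"
  shows "walk_prob n t S T
    = (\<Sum>x\<in>S. \<Sum>y\<in>T. fourier_kernel n (\<lambda>k. (1 - k / n) ^ t) x y) / card S"
proof -
  have "walk_prob n t S T = (\<Sum>y\<in>T. pmf (walk n (pmf_of_set S) t) y)"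
    using T finite_cube finite_subset unfolding walk_prob_def by (metis measure_measure_pmf_finite)
  also have "\<dots> = (\<Sum>y\<in>T. (\<Sum>x\<in>S. fourier_kernel n (\<lambda>k. (1 - k / n) ^ t) x y) / card S)"
    using T by (intro sum.cong[OF refl] pmf_walk_fourier[OF assms(1) S]) blast
  also have "\<dots> = (\<Sum>x\<in>S. \<Sum>y\<in>T. fourier_kernel n (\<lambda>k. (1 - k / n) ^ t) x y) / card S"
    by (subst sum.swap) (simp add: sum_divide_distrib)
  finally show ?thesis .
qed

section \<open>Comparison of the walk with the noise operator\<close>

lemma sum_fourier_kernel:
  "(\<Sum>x\<in>S. \<Sum>y\<in>T. fourier_kernel n c x y)
    = (\<Sum>A\<in>Pow {1..n}. c (card A) * ((\<Sum>x\<in>S. character A x) * (\<Sum>y\<in>T. character A y))) / 2 ^ n"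
proof -
  have split: "c (card A) * ((\<Sum>x\<in>S. character A x) * (\<Sum>y\<in>T. character A y))
      = (\<Sum>x\<in>S. \<Sum>y\<in>T. c (card A) * (character A x * character A y))" for A
    unfolding sum_product by (simp only: sum_distrib_left)
  have "(\<Sum>x\<in>S. \<Sum>y\<in>T. \<Sum>A\<in>Pow {1..n}. c (card A) * (character A x * character A y))
      = (\<Sum>x\<in>S. \<Sum>A\<in>Pow {1..n}. \<Sum>y\<in>T. c (card A) * (character A x * character A y))"
    by (rule sum.cong[OF refl sum.swap])
  also have "\<dots> = (\<Sum>A\<in>Pow {1..n}. \<Sum>x\<in>S. \<Sum>y\<in>T. c (card A) * (character A x * character A y))"
    by (rule sum.swap)
  also have "\<dots> = (\<Sum>A\<in>Pow {1..n}. c (card A) * ((\<Sum>x\<in>S. character A x) * (\<Sum>y\<in>T. character A y)))"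
    by (simp only: split)
  finally show ?thesis
    by (simp add: fourier_kernel_def flip: sum_divide_distrib)
qed

text \<open>Parseval's identity for the indicator function of \<open>S\<close>, read off from the kernel of the
  identity operator.\<close>

lemma parseval_set:
  assumes S: "S \<subseteq> cube n"
  shows "(\<Sum>A\<in>Pow {1..n}. (\<Sum>x\<in>S. character A x)\<^sup>2) = 2 ^ n * card S"
proof -
  have fin: "finite S" using S finite_cube finite_subset by blast
  have "(\<Sum>x\<in>S. \<Sum>y\<in>S. noise_kernel 1 n x y) = (\<Sum>x\<in>S. \<Sum>y\<in>S. if x = y then 1 else 0)"
    using S by (intro sum.cong) (auto simp: noise_kernel_1 subset_iff)
  also have "\<dots> = card S" using fin by simp
  finally show ?thesis
    by (simp add: noise_kernel_fourier[abs_def] sum_fourier_kernel power2_eq_square field_simps)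
qed

text \<open>The difference of the two operators has norm at most \<open>\<epsilon>\<close> on square-summable functions, because
  the characters diagonalize both; the rest is Cauchy--Schwarz and Parseval.\<close>

lemma fourier_kernel_sets_diff_le:
  assumes S: "S \<subseteq> cube n" and T: "T \<subseteq> cube n"
    and close: "\<And>k. k \<le> n \<Longrightarrow> \<bar>c k - d k\<bar> \<le> \<epsilon>"
  shows "\<bar>(\<Sum>x\<in>S. \<Sum>y\<in>T. fourier_kernel n c x y) - (\<Sum>x\<in>S. \<Sum>y\<in>T. fourier_kernel n d x y)\<bar>
    \<le> \<epsilon> * sqrt (real (card S) * real (card T))"
proof -
  define a b where "a A = (\<Sum>x\<in>S. character A x)" and "b A = (\<Sum>y\<in>T. character A y)" for A
  have \<epsilon>: "0 \<le> \<epsilon>" using close[of 0] by linarith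
  have card: "card A \<le> n" if "A \<in> Pow {1..n}" for A
    using that card_mono[of "{1..n}" A] by simp
  have "\<bar>\<Sum>A\<in>Pow {1..n}. (c (card A) - d (card A)) * (a A * b A)\<bar>
      \<le> (\<Sum>A\<in>Pow {1..n}. \<bar>(c (card A) - d (card A)) * (a A * b A)\<bar>)"
    by (rule sum_abs)
  also have "\<dots> \<le> (\<Sum>A\<in>Pow {1..n}. \<epsilon> * (\<bar>a A\<bar> * \<bar>b A\<bar>))"
    using close card by (intro sum_mono) (auto simp: abs_mult intro!: mult_right_mono)
  also have "\<dots> \<le> \<epsilon> * (L2_set a (Pow {1..n}) * L2_set b (Pow {1..n}))"
    unfolding sum_distrib_left[symmetric] by (intro mult_left_mono L2_set_mult_ineq \<epsilon>)
  also have "L2_set a (Pow {1..n}) * L2_set b (Pow {1..n})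
      = 2 ^ n * sqrt (real (card S) * real (card T))"
    unfolding L2_set_def a_def b_def parseval_set[OF S] parseval_set[OF T]
    by (simp add: real_sqrt_mult)
  finally have "\<bar>\<Sum>A\<in>Pow {1..n}. (c (card A) - d (card A)) * (a A * b A)\<bar>
      \<le> \<epsilon> * (2 ^ n * sqrt (real (card S) * real (card T)))" .
  then have "\<bar>\<Sum>A\<in>Pow {1..n}. (c (card A) - d (card A)) * (a A * b A)\<bar> / 2 ^ n
      \<le> \<epsilon> * sqrt (real (card S) * real (card T))"
    by (simp add: pos_divide_le_eq mult_ac)
  then show ?thesis
    by (simp add: sum_fourier_kernel a_def b_def left_diff_distrib sum_subtractf
        flip: diff_divide_distrib)
qed

text \<open>Bernoulli's inequality gives \<open>(1 - u\<^sup>2) ^ t \<ge> 1 - t u\<^sup>2\<close>, and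
  \<open>1 - u\<^sup>2 \<le> (1 - u) exp u\<close>. Hence the difference is at most \<open>t u\<^sup>2 exp (- t u)\<close>, which is
  \<open>v\<^sup>2 exp (- v) / t\<close> for \<open>v = t u\<close>, and \<open>v\<^sup>2 \<le> 2 exp v\<close>.\<close>

lemma exp_minus_power_close:
  fixes u :: real
  assumes u: "0 \<le> u" "u \<le> 1" and t: "t \<ge> 1"
  shows "\<bar>exp (- (t * u)) - (1 - u) ^ t\<bar> \<le> 2 / real t"
proof -
  have exp_t: "exp (- (t * u)) = exp (- u) ^ t"
    by (simp add: exp_of_nat_mult[symmetric])
  have "(1 - u) ^ t \<le> exp (- u) ^ t"
    using u exp_ge_add_one_self[of "- u"] by (intro power_mono) auto
  then have nonneg: "0 \<le> exp (- (t * u)) - (1 - u) ^ t"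
    by (simp add: exp_t)
  have "1 - t * u\<^sup>2 \<le> (1 - u\<^sup>2) ^ t"
    using Bernoulli_inequality[of "- u\<^sup>2" t] u by (simp add: power_le_one_iff)
  also have "\<dots> = (1 - u) ^ t * (1 + u) ^ t"
    by (simp add: power2_eq_square algebra_simps flip: power_mult_distrib)
  also have "\<dots> \<le> (1 - u) ^ t * exp u ^ t"
    using u by (intro mult_left_mono power_mono) auto
  finally have "exp (- u) ^ t * (1 - t * u\<^sup>2) \<le> exp (- u) ^ t * ((1 - u) ^ t * exp u ^ t)"
    by (rule mult_left_mono) simp
  also have "\<dots> = (1 - u) ^ t * (exp (- u) * exp u) ^ t"
    by (simp only: power_mult_distrib mult_ac)
  also have "exp (- u) * exp u = 1"
    by (simp flip: exp_add)
  finally have upper: "exp (- (t * u)) - (1 - u) ^ t \<le> exp (- (t * u)) * (t * u\<^sup>2)"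
    by (simp add: exp_t right_diff_distrib)
  have "1 + t * u + (t * u)\<^sup>2 / 2 \<le> exp (t * u)"
    using u by (intro exp_lower_Taylor_quadratic) simp
  moreover have "0 \<le> t * u" using u by simp
  ultimately have "(t * u)\<^sup>2 \<le> 2 * exp (t * u)" by linarith
  then have "exp (- (t * u)) * (t * u)\<^sup>2 \<le> 2"
    by (simp add: exp_minus field_simps)
  then have "exp (- (t * u)) * (t * u\<^sup>2) \<le> 2 / t"
    using t by (simp add: field_simps power2_eq_square)
  with upper nonneg show ?thesis by simp
qed

text \<open>The eigenvalues \<open>(1 - k/n) ^ t\<close> of the walk and \<open>exp (- \<tau> k)\<close> of the noise operator differ by
  at most \<open>2/t\<close>: take \<open>u = k/n\<close> above.\<close>

lemma walk_prob_ge_noise: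
  assumes n: "n \<ge> 1" and t: "t \<ge> 1" and \<tau>: "\<tau> * real n = real t"
    and S: "S \<subseteq> cube n" "S \<noteq> {}" and T: "T \<subseteq> cube n"
  shows "walk_prob n t S T \<ge> (\<Sum>x\<in>S. \<Sum>y\<in>T. noise_kernel (exp (- \<tau>)) n x y) / card S
    - 2 / real t * (sqrt (real (card S) * real (card T)) / card S)"
proof -
  have close: "\<bar>exp (- \<tau>) ^ k - (1 - k / n) ^ t\<bar> \<le> 2 / real t" if "k \<le> n" for k
  proof -
    have "\<tau> = real t / real n" using n \<tau> by (simp add: field_simps)
    then have "exp (- \<tau>) ^ k = exp (- (t * (k / n)))"
      by (simp add: exp_of_nat_mult[symmetric] mult_ac)
    then show ?thesis
      using exp_minus_power_close[of "k / n" t] t n that by simp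
  qed
  let ?N = "\<Sum>x\<in>S. \<Sum>y\<in>T. noise_kernel (exp (- \<tau>)) n x y"
  let ?W = "\<Sum>x\<in>S. \<Sum>y\<in>T. fourier_kernel n (\<lambda>k. (1 - k / n) ^ t) x y"
  have "\<bar>?N - ?W\<bar> \<le> 2 / real t * sqrt (real (card S) * real (card T))"
    unfolding noise_kernel_fourier by (rule fourier_kernel_sets_diff_le[OF S(1) T close])
  then have "?N - 2 / real t * sqrt (real (card S) * real (card T)) \<le> ?W" by linarith
  then have "(?N - 2 / real t * sqrt (real (card S) * real (card T))) / card S \<le> ?W / card S"
    by (rule divide_right_mono) simp
  then show ?thesis
    unfolding walk_prob_fourier[OF n S T] by (simp add: diff_divide_distrib)
qed

text \<open>The error of the comparison is \<open>2/t\<close> times the square root of \<open>|S| |T|\<close> divided by \<open>|S|\<close>,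
  which is the stated power of \<open>\<sigma>\<close>.\<close>

theorem walk_prob_ge:
  assumes \<tau>: "\<tau> > 0" "\<tau> * real n = real t" and n: "n \<ge> 1" and t: "t \<ge> 1"
    and S: "S \<subseteq> cube n" "S \<noteq> {}" and T: "T \<subseteq> cube n"
    and \<sigma>: "\<sigma> = card S / 2 ^ n" and \<alpha>: "0 \<le> \<alpha>" "card T / 2 ^ n = \<sigma> powr \<alpha>"
  shows "walk_prob n t S T \<ge> \<sigma> powr ((sqrt \<alpha> + exp (- \<tau>))\<^sup>2 / (1 - exp (- 2 * \<tau>)))
    - 2 * (\<sigma> powr ((- 1 + \<alpha>) / 2) / (\<tau> * real n))"
proof -
  have "finite S" using S finite_cube finite_subset by blast
  then have cS: "0 < card S" using S by (simp add: card_gt_0_iff)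
  then have \<sigma>0: "0 < \<sigma>" using \<sigma> by simp
  have cards: "real (card S) = 2 ^ n * \<sigma>" "real (card T) = 2 ^ n * \<sigma> powr \<alpha>"
    using \<sigma> \<alpha>(2) by (simp_all add: field_simps)
  have "sqrt (real (card S) * real (card T)) / card S = sqrt (\<sigma> * \<sigma> powr \<alpha>) / \<sigma>"
  proof -
    have "sqrt (real (card S) * real (card T)) = sqrt ((2 ^ n)\<^sup>2 * (\<sigma> * \<sigma> powr \<alpha>))"
      unfolding cards by (simp add: power2_eq_square mult_ac)
    also have "\<dots> = 2 ^ n * sqrt (\<sigma> * \<sigma> powr \<alpha>)"
      by (simp add: real_sqrt_mult)
    finally show ?thesis by (simp add: cards(1))
  qed
  also have "\<dots> = (\<sigma> powr (1 + \<alpha>)) powr (1 / 2) / \<sigma> powr 1"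
    using \<sigma>0 by (simp add: powr_half_sqrt powr_add)
  also have "\<dots> = \<sigma> powr ((- 1 + \<alpha>) / 2)"
    by (simp only: powr_powr powr_diff[symmetric]) (simp add: field_simps)
  finally have err: "sqrt (real (card S) * real (card T)) / card S = \<sigma> powr ((- 1 + \<alpha>) / 2)" .
  have "exp (- 2 * \<tau>) = (exp (- \<tau>))\<^sup>2"
    by (simp add: exp_double[symmetric])
  then have "\<sigma> powr ((sqrt \<alpha> + exp (- \<tau>))\<^sup>2 / (1 - exp (- 2 * \<tau>)))
      \<le> (\<Sum>x\<in>S. \<Sum>y\<in>T. noise_kernel (exp (- \<tau>)) n x y) / card S"
    using noise_kernel_sets_ge_powr[of "exp (- \<tau>)", OF _ _ S T \<sigma> \<alpha>] \<tau>(1) by simp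
  with walk_prob_ge_noise[OF n t \<tau>(2) S T] show ?thesis
    unfolding err \<tau>(2) by simp
qed

theorem proposition3p6:
  "\<exists>C::real. C > 0 \<and>
    (\<forall>(\<tau>::real) (n::nat) (t::nat) S T (\<sigma>::real).
       \<tau> > 0 \<longrightarrow> n \<ge> 1 \<longrightarrow> t \<ge> 1 \<longrightarrow> \<tau> * real n = real t \<longrightarrow>
       S \<subseteq> cube n \<longrightarrow> T \<subseteq> cube n \<longrightarrow> S \<noteq> {} \<longrightarrow> T \<noteq> {} \<longrightarrow>
       \<sigma> = real (card S) / 2 ^ n \<longrightarrow>
       (\<forall>\<alpha>::real. \<alpha> \<ge> 0 \<longrightarrow> real (card T) / 2 ^ n = \<sigma> powr \<alpha> \<longrightarrow>
          walk_prob n t S T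
            \<ge> \<sigma> powr ((sqrt \<alpha> + exp (- \<tau>))\<^sup>2 / (1 - exp (- 2 * \<tau>)))
              - C * (\<sigma> powr ((- 1 + \<alpha>) / 2) / (\<tau> * real n))) \<and>
       (card T = card S \<longrightarrow>
          walk_prob n t S T
            \<ge> \<sigma> powr ((1 + exp (- \<tau>)) / (1 - exp (- \<tau>)))
              - C / (\<tau> * real n)))"
proof (intro exI[of _ 2] conjI allI impI)
  fix \<tau> :: real and n t :: nat and S T \<sigma>
  assume hyps: "\<tau> > 0" "n \<ge> 1" "t \<ge> 1" "\<tau> * real n = real t" "S \<subseteq> cube n" "T \<subseteq> cube n"
    "S \<noteq> {}" "\<sigma> = real (card S) / 2 ^ n"
  note bound = walk_prob_ge[OF hyps(1,4,2,3,5,7,6,8)]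
  show "walk_prob n t S T \<ge> \<sigma> powr ((sqrt \<alpha> + exp (- \<tau>))\<^sup>2 / (1 - exp (- 2 * \<tau>)))
      - 2 * (\<sigma> powr ((- 1 + \<alpha>) / 2) / (\<tau> * real n))"
    if "\<alpha> \<ge> 0" "real (card T) / 2 ^ n = \<sigma> powr \<alpha>" for \<alpha>
    using bound[OF that] .
  show "walk_prob n t S T \<ge> \<sigma> powr ((1 + exp (- \<tau>)) / (1 - exp (- \<tau>))) - 2 / (\<tau> * real n)"
    if "card T = card S"
  proof -
    have "finite S" using hyps finite_cube finite_subset by blast
    then have \<sigma>0: "0 < \<sigma>" using hyps by (simp add: card_gt_0_iff)
    have "1 - exp (- 2 * \<tau>) = (1 + exp (- \<tau>)) * (1 - exp (- \<tau>))"
      using exp_double[of "- \<tau>"] by (simp add: power2_eq_square algebra_simps)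
    moreover have "1 + exp (- \<tau>) \<noteq> 0"
      using exp_gt_zero[of "- \<tau>"] by linarith
    ultimately have "(sqrt 1 + exp (- \<tau>))\<^sup>2 / (1 - exp (- 2 * \<tau>))
        = (1 + exp (- \<tau>)) / (1 - exp (- \<tau>))"
      by (simp add: power2_eq_square)
    moreover have "\<sigma> powr 1 = \<sigma>" "\<sigma> powr ((- 1 + 1) / 2) = 1"
      using \<sigma>0 by simp_all
    ultimately show ?thesis
      using bound[of 1] that hyps(8) by simp
  qed
qed simp

end
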